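(* Let $a\neq 1$ be a positive integer with $a\not\equiv 0\pmod{10}$. Then $$V(a)=\begin{cases} \min\{v_2(a-1),v_5(a-1)\} & \text{if } a\equiv 1 \pmod{20},\\ \min\{v_2(a+1),v_5(a-1)\} & \text{if } a\equiv 11 \pmod{20},\\ v_5(a^2+1) & \text{if } a\equiv 2 \text{ or } 8 \pmod{10},\\ \min\{v_2(a+1),v_5(a^2+1)\} & \text{if } a\equiv 3 \text{ or } 7 \pmod{20},\\ \min\{v_2(a-1),v_5(a^2+1)\} & \text{if } a\equiv 13 \text{ or } 17 \pmod{20},\\ v_5(a+1) & \text{if } a\equiv 4 \pmod{10},\\ v_2(a-1) & \text{if } a\equiv 5 \pmod{20},\\ v_2(a+1) & \text{if } a\equiv 15 \pmod{20},\\ v_5(a-1) & \text{if } a\equiv 6 \pmod{10},\\ \min\{v_2(a-1),v_5(a+1)\} & \text{if } a\equiv 9 \pmod{20},\\ \min\{v_2(a+1),v_5(a+1)\} & \text{if } a\equiv 19 \pmod{20}. \end{cases}$$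
   Context: For a prime $p$, $v_p$ denotes the $p$-adic valuation on $\mathbb{Z}$. For an integer $a\ge 1$, the tetration ${}^{b}a$ is defined by ${}^{1}a=a$ and ${}^{b}a=a^{({}^{b-1}a)}$ for $b\ge 2$. For an integer $a\ge 2$ not divisible by $10$ and $b\ge 1$, let $\#S(a,b)$ be the non-negative integer $n$ such that ${}^{b}a\equiv {}^{b+1}a \pmod{10^{n}}$ and ${}^{b}a\not\equiv {}^{b+1}a\pmod{10^{n+1}}$. The congruence speed of $a$ at height $b$ is $V(a,b):=\#S(a,b)-\#S(a,b-1)$ for $b\ge 2$ and $V(a,1):=\#S(a,1)$, so that $\#S(a,b)=\sum_{i=1}^{b}V(a,i)$. It is known that $V(a,b)$ is constant for all sufficiently large $b$ (for instance for $b\ge a+1$); this eventual constant value is the constant congruence speed $V(a)$. *)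

theory Defs
  imports "HOL-Number_Theory.Number_Theory"
begin

text \<open>The value at height 0 is the usual convention \<open>1\<close>; it makes height 1 equal to \<open>a\<close>
  (see \<open>tetration_rec\<close>) and is not used otherwise.\<close>

primrec tetration :: "nat \<Rightarrow> nat \<Rightarrow> nat" where
  "tetration a 0 = 1"
| "tetration a (Suc b) = a ^ tetration a b"

lemma tetration_rec:
  "tetration a 1 = a"
  "b \<ge> 2 \<Longrightarrow> tetration a b = a ^ tetration a (b - 1)"
  by (simp, cases b) simp_all

definition stable_digits :: "nat \<Rightarrow> nat \<Rightarrow> nat" where
  "stable_digits a b =
    (THE n. [tetration a b = tetration a (b + 1)] (mod 10 ^ n)
          \<and> \<not> [tetration a b = tetration a (b + 1)] (mod 10 ^ (n + 1)))"

text \<open>Integer-valued, so that the subtraction is not truncated.  Only heights \<open>b \<ge> 1\<close> are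
  meaningful.\<close>

definition congruence_speed_at :: "nat \<Rightarrow> nat \<Rightarrow> int" where
  "congruence_speed_at a b =
    (if b = 1 then int (stable_digits a 1)
     else int (stable_digits a b) - int (stable_digits a (b - 1)))"

definition congruence_speed :: "nat \<Rightarrow> int" where
  "congruence_speed a = (THE v. \<forall>\<^sub>F b in sequentially. congruence_speed_at a b = v)"

text \<open>Both definite descriptions are justified: for \<open>a \<ge> 2\<close> the first one has a unique
  witness, and the
  second one has at most one.\<close>

lemma tetration_less_Suc:
  assumes "a \<ge> 2"
  shows "tetration a b < tetration a (Suc b)"
proof (induction b)
  case 0
  then show ?case using assms by simp
next
  case (Suc b)
  then show ?case using assms by (auto intro: power_strict_increasing)
qed

lemma stable_digits_ex1:
  assumes "a \<ge> 2"
  shows "\<exists>!n. [tetration a b = tetration a (b + 1)] (mod 10 ^ n)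
          \<and> \<not> [tetration a b = tetration a (b + 1)] (mod 10 ^ (n + 1))"
proof -
  define d where "d = tetration a (b + 1) - tetration a b"
  have less: "tetration a b < tetration a (b + 1)"
    using tetration_less_Suc[OF assms] by simp
  then have "d \<noteq> 0" by (simp add: d_def)
  have cong_iff: "[tetration a b = tetration a (b + 1)] (mod m) \<longleftrightarrow> m dvd d" for m
    using less cong_altdef_nat[of "tetration a b" "tetration a (b + 1)" m]
    by (simp add: d_def cong_sym_eq cong_altdef_nat)
  have dvd_iff: "10 ^ n dvd d \<longleftrightarrow> n \<le> multiplicity 10 d" for n
    by (rule power_dvd_iff_le_multiplicity) (use \<open>d \<noteq> 0\<close> in simp_all)
  show ?thesis
    unfolding cong_iff dvd_iff by (rule ex1I[of _ "multiplicity 10 d"]) auto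
qed

lemma congruence_speed_eqI:
  assumes "\<forall>\<^sub>F b in sequentially. congruence_speed_at a b = v"
  shows "congruence_speed a = v"
  unfolding congruence_speed_def
proof (rule the_equality)
  fix w assume "\<forall>\<^sub>F b in sequentially. congruence_speed_at a b = w"
  then have "\<forall>\<^sub>F b::nat in sequentially. v = w"
    using assms by eventually_elim simp
  then show "w = v" by simp
qed (rule assms)

end

theory Submission
  imports Defs
begin

text \<open>Let \<open>d b\<close> be the difference of the tetrations of heights \<open>b + 1\<close> and \<open>b\<close>, so that the number of
  stable digits is the smaller of the 2-adic and 5-adic valuations of \<open>d b\<close>.  The recursion
  \<open>d (b + 1) = a ^ t * (a ^ d b - 1)\<close>, with \<open>t\<close> the tetration of height \<open>b\<close>, shows two regimes for a
  prime \<open>p\<close>.  If \<open>p\<close> does not divide \<open>a\<close> and \<open>a ^ m\<close> is close enough to 1, lifting the exponent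
  makes the valuation of \<open>d b\<close> grow by the constant \<open>v (a ^ m - 1) - v m\<close> at each step.  If \<open>p\<close>
  divides \<open>a\<close>, the valuation is at least \<open>t\<close>, which overtakes every linear sequence.  Hence the
  minimum eventually grows by the smaller of the available constants.\<close>

section \<open>Lifting the exponent\<close>

lemma geometric_sum_cong:
  fixes x m :: int
  assumes "[x = 1] (mod m)"
  shows "[(\<Sum>i<n. x ^ i) = int n] (mod m)"
proof -
  have "[(\<Sum>i<n. x ^ i) = (\<Sum>i<n. 1)] (mod m)"
    by (rule cong_sum) (use cong_pow[OF assms] in simp)
  then show ?thesis by simp
qed

text \<open>The sum is congruent to \<open>p\<close> modulo \<open>p ^ 2\<close>, hence divisible by
  \<open>p\<close> exactly once. The difference from \<open>p\<close> is \<open>x - 1\<close> times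
  a double sum; for odd \<open>p\<close> the latter is congruent to
  \<open>0 + 1 + ... + (p - 1)\<close>, a multiple of \<open>p\<close>. For \<open>p = 2\<close> the
  difference is \<open>x - 1\<close> itself, which is why divisibility by 4 is assumed
  there.\<close>

lemma multiplicity_geometric_sum_prime:
  fixes x :: int and p :: nat
  assumes p: "prime p" and x: "[x = 1] (mod int p)" and x2: "p = 2 \<Longrightarrow> [x = 1] (mod 4)"
  shows "multiplicity (int p) (\<Sum>i<p. x ^ i) = 1"
proof -
  let ?S = "\<Sum>i<p. x ^ i"
  have sq: "int p ^ 2 dvd ?S - int p"
  proof (cases "p = 2")
    case True
    then show ?thesis
      using x2 by (simp add: cong_iff_dvd_diff numeral_2_eq_2 algebra_simps)
  next
    case False
    then have "odd p" using p primes_dvd_imp_eq two_is_prime_nat by blast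
    then obtain k where k: "p = 2 * k + 1" by (elim oddE)
    have "[(\<Sum>i<p. \<Sum>j<i. x ^ j) = (\<Sum>i<p. int i)] (mod int p)"
      by (intro cong_sum geometric_sum_cong x)
    moreover have "(\<Sum>i<p. int i) = int p * int k"
    proof -
      have "2 * (\<Sum>i<n. int i) = int n * (int n - 1)" for n
        by (induction n) (simp_all add: algebra_simps)
      from this[of p] show ?thesis by (simp add: k)
    qed
    ultimately have "int p dvd (\<Sum>i<p. \<Sum>j<i. x ^ j)"
      by (simp add: cong_dvd_iff)
    moreover have "?S - int p = (\<Sum>i<p. x ^ i - 1)"
      by (simp add: sum_subtractf)
    moreover have "\<dots> = (x - 1) * (\<Sum>i<p. \<Sum>j<i. x ^ j)"
      by (simp add: power_diff_1_eq sum_distrib_left)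
    ultimately show ?thesis
      using x by (simp add: cong_iff_dvd_diff power2_eq_square mult_dvd_mono)
  qed
  have "int p dvd ?S"
    using geometric_sum_cong[OF x, of p] by (simp add: cong_dvd_iff)
  moreover have "\<not> int p ^ 2 dvd ?S"
  proof
    assume "int p ^ 2 dvd ?S"
    with sq have "int p ^ 2 dvd int p"
      using dvd_diff[of "int p ^ 2" ?S "?S - int p"] by simp
    then have "int p * int p dvd int p * 1" by (simp add: power2_eq_square)
    then show False using p prime_gt_1_nat[OF p] by (subst (asm) dvd_mult_cancel_left) auto
  qed
  ultimately show ?thesis
    by (intro multiplicity_eqI) (simp_all add: numeral_2_eq_2)
qed

text \<open>Strong induction strips off one factor \<open>p\<close> of \<open>n\<close> at a time.
  If \<open>p\<close> does not divide \<open>n\<close>, the cofactor of \<open>x - 1\<close> in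
  \<open>x ^ n - 1\<close> is congruent to \<open>n\<close> and so prime to \<open>p\<close>; if
  \<open>n = p * k\<close>, the cofactor of \<open>x ^ k - 1\<close> contributes exactly one
  \<open>p\<close>. The claim \<open>x ^ n \<noteq> 1\<close> is carried along because the product
  rule for \<open>multiplicity\<close> needs nonzero factors.\<close>

lemma lifting_the_exponent:
  fixes x :: int and p n :: nat
  assumes p: "prime p" and x: "[x = 1] (mod int p)" and x2: "p = 2 \<Longrightarrow> [x = 1] (mod 4)"
    and "x \<noteq> 1" and "n > 0"
  shows "x ^ n \<noteq> 1 \<and>
    multiplicity (int p) (x ^ n - 1) = multiplicity (int p) (x - 1) + multiplicity (int p) (int n)"
  using \<open>n > 0\<close>
proof (induction n rule: less_induct)
  case (less n)
  have pi: "prime (int p)" using p by simp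
  show ?case
  proof (cases "p dvd n")
    case False
    let ?S = "\<Sum>i<n. x ^ i"
    have ndvd: "\<not> int p dvd int n" using False by simp
    then have nS: "\<not> int p dvd ?S"
      using geometric_sum_cong[OF x, of n] by (simp add: cong_dvd_iff)
    then have "?S \<noteq> 0" by auto
    then show ?thesis
      using nS ndvd pi \<open>x \<noteq> 1\<close>
      by (auto simp: power_diff_1_eq prime_elem_multiplicity_mult_distrib not_dvd_imp_multiplicity_0
          dest: arg_cong[of "x ^ n" 1 "\<lambda>y. y - 1"])
  next
    case True
    then obtain k where n: "n = p * k" by auto
    with less.prems have k: "k > 0" by auto
    moreover have "k < n" using n k prime_gt_1_nat[OF p] by simp
    ultimately have IH: "x ^ k \<noteq> 1"
      "multiplicity (int p) (x ^ k - 1) = multiplicity (int p) (x - 1) + multiplicity (int p) (int k)"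
      using less.IH by auto
    let ?S = "\<Sum>i<p. (x ^ k) ^ i"
    have S: "multiplicity (int p) ?S = 1"
      using multiplicity_geometric_sum_prime[of p "x ^ k"] p cong_pow[OF x, of k]
        cong_pow[OF x2, of k] by simp
    \<comment> \<open>By convention \<open>multiplicity\<close> of 0 is 0, so a value of 1 excludes
      a vanishing sum.\<close>
    then have S0: "?S \<noteq> 0" by (metis multiplicity_zero zero_neq_one)
    have eq: "x ^ n - 1 = (x ^ k - 1) * ?S"
      using power_diff_1_eq[of "x ^ k" p] by (simp add: n power_mult mult.commute)
    have "multiplicity (int p) (int n) = multiplicity (int p) (int k) + 1"
      using pi k prime_gt_1_nat[OF p]
      by (simp add: n prime_elem_multiplicity_mult_distrib)
    moreover have "x ^ n \<noteq> 1" using eq S0 IH(1) by auto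
    ultimately show ?thesis
      using pi S0 IH S by (simp add: eq prime_elem_multiplicity_mult_distrib)
  qed
qed

section \<open>Differences of consecutive tetrations and their valuations\<close>

text \<open>For \<open>a \<ge> 2\<close> tetrations increase strictly with the height, so the
  subtraction on naturals is not truncated.\<close>

definition tetration_diff :: "nat \<Rightarrow> nat \<Rightarrow> nat" where
  "tetration_diff a b = tetration a (Suc b) - tetration a b"

lemma tetration_diff_pos: "a \<ge> 2 \<Longrightarrow> tetration_diff a b > 0"
  using tetration_less_Suc[of a b] by (simp add: tetration_diff_def)

lemma tetration_diff_Suc:
  assumes "a \<ge> 2"
  shows "int (tetration_diff a (Suc b))
    = int a ^ tetration a b * (int a ^ tetration_diff a b - 1)"
proof -
  have "tetration a (Suc b) = tetration a b + tetration_diff a b"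
    using tetration_less_Suc[OF assms, of b] by (simp add: tetration_diff_def)
  then have "a ^ tetration a (Suc b) = a ^ tetration a b * a ^ tetration_diff a b"
    by (simp only: power_add)
  moreover have "tetration a (Suc b) < tetration a (Suc (Suc b))"
    by (rule tetration_less_Suc[OF assms])
  ultimately show ?thesis
    by (simp add: tetration_diff_def of_nat_diff right_diff_distrib)
qed

text \<open>Since 10 is not prime, the two sides are compared through their lower bounds
  \<open>n\<close>: as 2 and 5 are coprime, \<open>10 ^ n\<close> divides \<open>d\<close> exactly
  when both \<open>2 ^ n\<close> and \<open>5 ^ n\<close> do.\<close>

lemma multiplicity_10:
  fixes d :: nat
  assumes "d > 0"
  shows "multiplicity 10 d = min (multiplicity 2 (int d)) (multiplicity 5 (int d))"
proof -
  have "n \<le> multiplicity 10 d \<longleftrightarrow> n \<le> min (multiplicity 2 (int d)) (multiplicity 5 (int d))" for n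
  proof -
    have "n \<le> multiplicity 10 d \<longleftrightarrow> (2 * 5) ^ n dvd d"
      using assms by (subst power_dvd_iff_le_multiplicity) simp_all
    also have "\<dots> \<longleftrightarrow> 2 ^ n dvd d \<and> 5 ^ n dvd d"
      unfolding power_mult_distrib
      by (auto intro: divides_mult elim: dvd_mult_left dvd_mult_right)
    also have "\<dots> \<longleftrightarrow> 2 ^ n dvd int d \<and> 5 ^ n dvd int d"
      by (metis of_nat_dvd_iff of_nat_numeral of_nat_power)
    also have "\<dots> \<longleftrightarrow> n \<le> multiplicity 2 (int d) \<and> n \<le> multiplicity 5 (int d)"
      using assms by (simp add: power_dvd_iff_le_multiplicity)
    finally show ?thesis by simp
  qed
  then show ?thesis by (meson order_antisym order_refl)
qed

lemma stable_digits_eq: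
  assumes "a \<ge> 2"
  shows "stable_digits a b =
    min (multiplicity 2 (int (tetration_diff a b))) (multiplicity 5 (int (tetration_diff a b)))"
proof -
  let ?d = "tetration_diff a b"
  have cong_iff: "[tetration a b = tetration a (b + 1)] (mod m) \<longleftrightarrow> m dvd ?d" for m
    using tetration_less_Suc[OF assms, of b]
      cong_altdef_nat[of "tetration a b" "tetration a (b + 1)" m]
    by (simp add: tetration_diff_def cong_sym_eq cong_altdef_nat)
  have dvd_iff: "10 ^ n dvd ?d \<longleftrightarrow> n \<le> multiplicity 10 ?d" for n
    by (rule power_dvd_iff_le_multiplicity) (use tetration_diff_pos[OF assms, of b] in simp_all)
  have "stable_digits a b = multiplicity 10 ?d"
    unfolding stable_digits_def cong_iff dvd_iff by (rule the_equality) auto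
  then show ?thesis
    using multiplicity_10[OF tetration_diff_pos[OF assms]] by simp
qed

text \<open>Writing the difference at height \<open>b\<close> as \<open>m * k\<close>, the exponent
  is lifted from \<open>a ^ m\<close> to its \<open>k\<close>-th power; passing to
  \<open>a ^ m\<close> handles bases that are not 1 modulo \<open>p\<close>. The valuation of
  \<open>m\<close> stands on the left to avoid truncated subtraction.\<close>

lemma multiplicity_tetration_diff_Suc:
  fixes a b m p :: nat
  assumes a: "a \<ge> 2" and p: "prime p" and "\<not> p dvd a" and "m > 0" and "m dvd tetration_diff a b"
    and "[int a ^ m = 1] (mod int p)" and "p = 2 \<Longrightarrow> [int a ^ m = 1] (mod 4)"
  shows "multiplicity (int p) (int (tetration_diff a (Suc b))) + multiplicity (int p) (int m) =
    multiplicity (int p) (int (tetration_diff a b)) + multiplicity (int p) (int a ^ m - 1)"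
proof -
  have pi: "prime (int p)" using p by simp
  obtain k where k: "tetration_diff a b = m * k" using assms by auto
  have "k > 0" using k tetration_diff_pos[OF a, of b] by (cases k) auto
  have "1 < a ^ m" using a \<open>m > 0\<close> by (intro one_less_power) auto
  then have "int a ^ m \<noteq> 1" by (metis of_nat_1 of_nat_eq_iff of_nat_power less_irrefl)
  with assms \<open>k > 0\<close> have lte: "(int a ^ m) ^ k \<noteq> 1"
    "multiplicity (int p) ((int a ^ m) ^ k - 1) =
      multiplicity (int p) (int a ^ m - 1) + multiplicity (int p) (int k)"
    using lifting_the_exponent[of p "int a ^ m" k] by auto
  have "multiplicity (int p) (int a ^ tetration a b) = 0"
    using assms(3) pi prime_dvd_power[of "int p" "int a" "tetration a b"]
    by (intro not_dvd_imp_multiplicity_0) auto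
  moreover have "multiplicity (int p) (int (tetration_diff a b)) =
      multiplicity (int p) (int m) + multiplicity (int p) (int k)"
    using pi \<open>m > 0\<close> \<open>k > 0\<close> by (simp add: k prime_elem_multiplicity_mult_distrib)
  ultimately show ?thesis
    using lte pi a
    by (simp add: tetration_diff_Suc prime_elem_multiplicity_mult_distrib k power_mult)
qed

lemma tetration_ge: "a \<ge> 2 \<Longrightarrow> tetration a b \<ge> Suc b"
proof (induction b)
  case (Suc b)
  then show ?case using tetration_less_Suc[of a b] by simp
qed simp

lemma tetration_Suc_ge_double:
  assumes "a \<ge> 2"
  shows "tetration a (Suc b) \<ge> 2 * tetration a b"
proof -
  have "2 * n \<le> 2 ^ n" if "n \<ge> 1" for n :: nat
    using that by (induction n rule: dec_induct) simp_all
  from this[of "tetration a b"] have "2 * tetration a b \<le> 2 ^ tetration a b"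
    using tetration_ge[OF assms, of b] by simp
  also have "\<dots> \<le> a ^ tetration a b" using assms by (rule power_mono) simp
  finally show ?thesis by simp
qed

lemma multiplicity_tetration_diff_ge:
  fixes a b p :: nat
  assumes "a \<ge> 2" and "prime p" and "p dvd a"
  shows "multiplicity (int p) (int (tetration_diff a (Suc b))) \<ge> tetration a b"
proof (rule multiplicity_geI)
  show "int p ^ tetration a b dvd int (tetration_diff a (Suc b))"
    using assms by (simp add: tetration_diff_Suc dvd_power_same)
qed (use assms tetration_diff_pos[OF assms(1), of "Suc b"] prime_gt_1_nat[OF assms(2)] in auto)

lemma odd_square_cong_1_mod_8:
  fixes a :: nat
  assumes "odd a"
  shows "[int a ^ 2 = 1] (mod 8)"
proof -
  obtain k where k: "a = 2 * k + 1" using assms by (elim oddE)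
  obtain j where j: "k * (k + 1) = 2 * j" by (metis dvdE even_mult_iff even_plus_one_iff)
  have "int a ^ 2 - 1 = 4 * int (k * (k + 1))" by (simp add: k power2_eq_square algebra_simps)
  also have "\<dots> = 8 * int j" by (simp only: j)
  finally show ?thesis by (simp add: cong_iff_dvd_diff)
qed

lemma even_tetration_diff: "odd a \<Longrightarrow> even (tetration_diff a b)"
  by (cases b) (auto simp: tetration_diff_def)

text \<open>Guarantees that each exponent \<open>m\<close> in \<open>{1, 2, 4}\<close> used for the
  prime 5 divides the difference. An even \<open>a\<close> contributes a power with exponent at
  least 2; for odd \<open>a\<close> the previous difference is even, and even powers of
  \<open>a\<close> are 1 modulo 8. Height 1 is excluded: for \<open>a = 2\<close> the difference
  there is 2.\<close>

lemma dvd_4_tetration_diff: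
  assumes "a \<ge> 2" and "b \<ge> 2"
  shows "4 dvd tetration_diff a b"
proof -
  obtain c where b: "b = Suc (Suc c)" using \<open>b \<ge> 2\<close> by (metis add_2_eq_Suc le_Suc_ex)
  have "4 dvd int (tetration_diff a b)"
  proof (cases "even a")
    case True
    have "2 \<le> tetration a (Suc c)" using tetration_ge[OF assms(1), of "Suc c"] by simp
    then have "int a ^ 2 dvd int a ^ tetration a (Suc c)" by (rule le_imp_power_dvd)
    moreover have "4 dvd int a ^ 2"
      using True dvd_power_same[of 2 "int a" 2] by simp
    ultimately show ?thesis
      using assms by (auto simp: b tetration_diff_Suc[of _ "Suc c"] intro!: dvd_mult2 elim: dvd_trans)
  next
    case False
    obtain k where k: "tetration_diff a (Suc c) = 2 * k" using even_tetration_diff[OF False] by blast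
    have "[(int a ^ 2) ^ k = 1 ^ k] (mod 8)" by (intro cong_pow odd_square_cong_1_mod_8 False)
    then have "8 dvd int a ^ tetration_diff a (Suc c) - 1"
      by (simp add: k power_mult cong_iff_dvd_diff)
    then have "4 dvd int a ^ tetration_diff a (Suc c) - 1" by (rule dvd_trans[rotated]) simp
    then show ?thesis using assms by (simp add: b tetration_diff_Suc[of _ "Suc c"])
  qed
  then show ?thesis by presburger
qed

section \<open>Growth of the minimum of two sequences\<close>

lemma eventually_le_if_faster_growth:
  fixes f g :: "nat \<Rightarrow> nat"
  assumes "\<forall>\<^sub>F b in sequentially. f (Suc b) = f b + s"
    and "\<forall>\<^sub>F b in sequentially. g (Suc b) \<ge> g b + s + 1"
  shows "\<forall>\<^sub>F b in sequentially. f b \<le> g b"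
proof -
  have "\<forall>\<^sub>F b in sequentially. f (Suc b) = f b + s \<and> g (Suc b) \<ge> g b + s + 1"
    using assms by (rule eventually_conj)
  then obtain N where N: "f (Suc b) = f b + s" "g (Suc b) \<ge> g b + s + 1" if "b \<ge> N" for b
    unfolding eventually_sequentially by blast
  \<comment> \<open>The lead of \<open>f\<close> over \<open>g\<close> at \<open>N\<close> is at
    most \<open>f N\<close> and shrinks by at least 1 per step, so \<open>f N\<close> steps suffice.
    The additive form avoids truncated subtraction.\<close>
  have gap: "f (N + n) + n \<le> g (N + n) + f N" for n
  proof (induction n)
    case (Suc n)
    then show ?case using N[of "N + n"] by simp
  qed simp
  have "f b \<le> g b" if "b \<ge> N + f N" for b
    using gap[of "b - N"] that by simp
  then show ?thesis unfolding eventually_sequentially by blast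
qed

lemma eventually_min_increment:
  fixes f g :: "nat \<Rightarrow> nat"
  assumes "\<forall>\<^sub>F b in sequentially. f (Suc b) = f b + s"
    and "\<forall>\<^sub>F b in sequentially. f b \<le> g b"
  shows "\<forall>\<^sub>F b in sequentially. min (f (Suc b)) (g (Suc b)) = min (f b) (g b) + s"
proof -
  have "\<forall>\<^sub>F b in sequentially. f (Suc b) \<le> g (Suc b)"
    using assms(2) by (subst eventually_sequentially_Suc)
  with assms show ?thesis by eventually_elim (simp add: min_def)
qed

text \<open>The sequence with the smaller slope eventually is the minimum; with equal slopes both
  entries shift by the same amount at every step.\<close>

lemma eventually_min_increment_linear:
  fixes f g :: "nat \<Rightarrow> nat"
  assumes f: "\<forall>\<^sub>F b in sequentially. f (Suc b) = f b + s"
    and g: "\<forall>\<^sub>F b in sequentially. g (Suc b) = g b + r"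
  shows "\<forall>\<^sub>F b in sequentially. min (f (Suc b)) (g (Suc b)) = min (f b) (g b) + min s r"
proof (cases s r rule: linorder_cases)
  case less
  have "\<forall>\<^sub>F b in sequentially. g (Suc b) \<ge> g b + s + 1"
    using g by eventually_elim (use less in simp)
  from eventually_min_increment[OF f eventually_le_if_faster_growth[OF f this]] show ?thesis
    using less by (simp add: min_def)
next
  case equal
  show ?thesis using f g by eventually_elim (simp add: equal min_def)
next
  case greater
  have "\<forall>\<^sub>F b in sequentially. f (Suc b) \<ge> f b + r + 1"
    using f by eventually_elim (use greater in simp)
  from eventually_min_increment[OF g eventually_le_if_faster_growth[OF g this]] show ?thesis
    using greater by (simp add: min.commute)
qed

section \<open>The congruence speed in terms of \<open>a ^ m - 1\<close>\<close>

lemma congruence_speed_eq: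
  assumes "\<forall>\<^sub>F b in sequentially. stable_digits a (Suc b) = stable_digits a b + s"
  shows "congruence_speed a = int s"
proof (rule congruence_speed_eqI)
  have "\<forall>\<^sub>F b in sequentially. congruence_speed_at a (Suc b) = int s"
    \<comment> \<open>Positivity of \<open>b\<close> keeps \<open>Suc b\<close> away from the
      special clause of \<open>congruence_speed_at\<close> at height 1.\<close>
    using assms eventually_gt_at_top[of 0]
    by eventually_elim (simp add: congruence_speed_at_def)
  then show "\<forall>\<^sub>F b in sequentially. congruence_speed_at a b = int s"
    by (subst (asm) eventually_sequentially_Suc)
qed

text \<open>The valuation is only known to be bounded below by the tetration one height lower, so
  \<open>f\<close>, shifted by one, is compared with the tetration instead: from
  \<open>b = s\<close> on, doubling a value of at least \<open>b + 1\<close> adds at least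
  \<open>s + 1\<close>.\<close>

lemma multiplicity_tetration_diff_dominates:
  fixes a p :: nat
  assumes "a \<ge> 2" and "prime p" and "p dvd a"
    and f: "\<forall>\<^sub>F b in sequentially. f (Suc b) = f b + s"
  shows "\<forall>\<^sub>F b in sequentially. f b \<le> multiplicity (int p) (int (tetration_diff a b))"
proof -
  have "\<forall>\<^sub>F b in sequentially. f (Suc (Suc b)) = f (Suc b) + s"
    using f by (subst eventually_sequentially_Suc)
  moreover have "\<forall>\<^sub>F b in sequentially. tetration a (Suc b) \<ge> tetration a b + s + 1"
    using eventually_ge_at_top[of s]
  proof eventually_elim
    case (elim b)
    then show ?case
      using tetration_ge[OF assms(1), of b] tetration_Suc_ge_double[OF assms(1), of b] by linarith
  qed
  ultimately have "\<forall>\<^sub>F b in sequentially. f (Suc b) \<le> tetration a b"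
    by (rule eventually_le_if_faster_growth)
  then have "\<forall>\<^sub>F b in sequentially.
      f (Suc b) \<le> multiplicity (int p) (int (tetration_diff a (Suc b)))"
    by eventually_elim (use multiplicity_tetration_diff_ge[OF assms(1-3)] order_trans in blast)
  then show ?thesis by (subst (asm) eventually_sequentially_Suc)
qed

text \<open>The choice \<open>m = 2\<close> covers every odd \<open>a\<close>, since odd squares are
  1 modulo 4. The subtracted 1 is the 2-adic valuation of \<open>m\<close>, and it is not truncated
  because \<open>a ^ 2 - 1\<close> is even and nonzero.\<close>

lemma multiplicity_2_increment:
  assumes "a \<ge> 2" and "odd a"
  shows "\<forall>\<^sub>F b in sequentially. multiplicity 2 (int (tetration_diff a (Suc b))) =
    multiplicity 2 (int (tetration_diff a b)) + (multiplicity 2 (int a ^ 2 - 1) - 1)"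
proof (rule always_eventually, rule allI)
  fix b
  have sq: "[int a ^ 2 = 1] (mod m)" if "m dvd 8" for m
    using odd_square_cong_1_mod_8[OF assms(2)] that by (rule cong_dvd_modulus)
  have "a ^ 2 \<noteq> 1" using assms by simp
  then have "int a ^ 2 - 1 \<noteq> 0" by (metis eq_iff_diff_eq_0 of_nat_1 of_nat_eq_iff of_nat_power)
  then have "multiplicity 2 (int a ^ 2 - 1) \<ge> 1"
    using sq[of 2] by (intro multiplicity_geI) (auto simp: cong_iff_dvd_diff)
  then show "multiplicity 2 (int (tetration_diff a (Suc b))) =
    multiplicity 2 (int (tetration_diff a b)) + (multiplicity 2 (int a ^ 2 - 1) - 1)"
    using multiplicity_tetration_diff_Suc[of a 2 2 b] assms sq[of 2] sq[of 4]
      even_tetration_diff[of a b] by simp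
qed

text \<open>Here \<open>m\<close> is prime to 5, so no correction term appears. The recurrence is
  claimed from height 2 on, where 4 and hence \<open>m\<close> divides the difference.\<close>

lemma multiplicity_5_increment:
  assumes "a \<ge> 2" and "m \<in> {1, 2, 4}" and "[int a ^ m = 1] (mod 5)"
  shows "\<forall>\<^sub>F b in sequentially. multiplicity 5 (int (tetration_diff a (Suc b))) =
    multiplicity 5 (int (tetration_diff a b)) + multiplicity 5 (int a ^ m - 1)"
  using eventually_ge_at_top[of 2]
proof eventually_elim
  case (elim b)
  have "m dvd 4" using assms(2) by auto
  then have "m dvd tetration_diff a b"
    using dvd_4_tetration_diff[OF assms(1) elim] dvd_trans by blast
  moreover have "\<not> 5 dvd a"
  proof
    assume "5 dvd a"
    then have "5 dvd int a ^ m" using assms(2) by (auto intro: dvd_power_le)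
    then show False using assms(3) by (simp add: cong_dvd_iff)
  qed
  moreover have "multiplicity 5 (int m) = 0"
    using assms(2) by (auto intro!: not_dvd_imp_multiplicity_0)
  ultimately show ?case
    using multiplicity_tetration_diff_Suc[of a 5 m b] assms by auto
qed

lemma congruence_speed_coprime:
  assumes "a \<ge> 2" and "odd a" and "m \<in> {1, 2, 4}" and "[int a ^ m = 1] (mod 5)"
  shows "congruence_speed a =
    int (min (multiplicity 2 (int a ^ 2 - 1) - 1) (multiplicity 5 (int a ^ m - 1)))"
  by (rule congruence_speed_eq, unfold stable_digits_eq[OF assms(1)])
    (intro eventually_min_increment_linear multiplicity_2_increment multiplicity_5_increment assms)

text \<open>The 5-adic valuation grows linearly while the 2-adic one overtakes it, so the prime 5
  alone determines the speed.\<close>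

lemma congruence_speed_even:
  assumes "a \<ge> 2" and "even a" and "m \<in> {1, 2, 4}" and "[int a ^ m = 1] (mod 5)"
  shows "congruence_speed a = int (multiplicity 5 (int a ^ m - 1))"
proof (rule congruence_speed_eq)
  note inc = multiplicity_5_increment[OF assms(1,3,4)]
  show "\<forall>\<^sub>F b in sequentially. stable_digits a (Suc b) =
      stable_digits a b + multiplicity 5 (int a ^ m - 1)"
    unfolding stable_digits_eq[OF assms(1)]
    using eventually_min_increment[OF inc
        multiplicity_tetration_diff_dominates[of a 2, OF assms(1) _ assms(2) inc]]
    by (simp add: min.commute)
qed

lemma congruence_speed_dvd_5:
  assumes "a \<ge> 2" and "odd a" and "5 dvd a"
  shows "congruence_speed a = int (multiplicity 2 (int a ^ 2 - 1) - 1)"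
proof (rule congruence_speed_eq)
  note inc = multiplicity_2_increment[OF assms(1,2)]
  show "\<forall>\<^sub>F b in sequentially. stable_digits a (Suc b) =
      stable_digits a b + (multiplicity 2 (int a ^ 2 - 1) - 1)"
    unfolding stable_digits_eq[OF assms(1)]
    using eventually_min_increment[OF inc
        multiplicity_tetration_diff_dominates[of a 5, OF assms(1) _ assms(3) inc]]
    by simp
qed

section \<open>Reduction to the valuations of \<open>a - 1\<close>, \<open>a + 1\<close> and
  \<open>a ^ 2 + 1\<close>\<close>

text \<open>Of the factors \<open>a - 1\<close> and \<open>a + 1\<close>, one is 2 modulo 4 and
  contributes exactly the 1 that is subtracted.\<close>

lemma multiplicity_2_square_minus_1:
  fixes a :: nat
  assumes "a \<ge> 2"
  shows "[a = 1] (mod 4) \<Longrightarrow> multiplicity 2 (int a ^ 2 - 1) - 1 = multiplicity 2 (int a - 1)"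
    and "[a = 3] (mod 4) \<Longrightarrow> multiplicity 2 (int a ^ 2 - 1) - 1 = multiplicity 2 (int a + 1)"
proof -
  have eq: "multiplicity 2 (int a ^ 2 - 1) = multiplicity 2 (int a - 1) + multiplicity 2 (int a + 1)"
    using assms prime_elem_multiplicity_mult_distrib[of 2 "int a - 1" "int a + 1"]
    by (simp add: power2_eq_square algebra_simps)
  have one: "multiplicity 2 y = 1" if "y mod 4 = 2" for y :: int
    using that by (intro multiplicity_eqI) (simp_all, presburger+)
  { assume "[a = 1] (mod 4)"
    then have "(int a + 1) mod 4 = 2" unfolding cong_def by presburger
    from one[OF this] show "multiplicity 2 (int a ^ 2 - 1) - 1 = multiplicity 2 (int a - 1)"
      by (simp add: eq) }
  { assume "[a = 3] (mod 4)"
    then have "(int a - 1) mod 4 = 2" unfolding cong_def by presburger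
    from one[OF this] show "multiplicity 2 (int a ^ 2 - 1) - 1 = multiplicity 2 (int a + 1)"
      by (simp add: eq) }
qed

lemma multiplicity_5_square_minus_1:
  fixes a :: nat
  assumes "a \<ge> 2" and "[a = 4] (mod 5)"
  shows "[int a ^ 2 = 1] (mod 5)" and "multiplicity 5 (int a ^ 2 - 1) = multiplicity 5 (int a + 1)"
proof -
  have eq: "int a ^ 2 - 1 = (int a - 1) * (int a + 1)" by (simp add: power2_eq_square algebra_simps)
  have dvd: "\<not> 5 dvd int a - 1" "5 dvd int a + 1"
    using assms(2) unfolding cong_def by presburger+
  then show "[int a ^ 2 = 1] (mod 5)" by (simp add: cong_iff_dvd_diff eq)
  show "multiplicity 5 (int a ^ 2 - 1) = multiplicity 5 (int a + 1)"
    using dvd assms(1) by (simp add: eq prime_elem_multiplicity_mult_distrib not_dvd_imp_multiplicity_0)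
qed

text \<open>In \<open>(a ^ 2 - 1) * (a ^ 2 + 1)\<close> the first factor is prime to 5, because
  \<open>a ^ 2\<close> is 4 modulo 5.\<close>

lemma multiplicity_5_power4_minus_1:
  fixes a :: nat
  assumes "a \<ge> 2" and "[a = 2] (mod 5) \<or> [a = 3] (mod 5)"
  shows "[int a ^ 4 = 1] (mod 5)" and "multiplicity 5 (int a ^ 4 - 1) = multiplicity 5 ((int a)^2 + 1)"
proof -
  have eq: "int a ^ 4 - 1 = (int a ^ 2 - 1) * (int a ^ 2 + 1)"
    by (simp add: power4_eq_xxxx power2_eq_square algebra_simps)
  have "int a mod 5 = 2 \<or> int a mod 5 = 3"
    using assms(2) zmod_int[of a 5] by (auto simp: cong_def)
  then have "int a ^ 2 mod 5 = 4"
    using power_mod[of "int a" 5 2] by auto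
  then have dvd: "\<not> 5 dvd int a ^ 2 - 1" "5 dvd int a ^ 2 + 1" by presburger+
  then show "[int a ^ 4 = 1] (mod 5)" by (simp add: cong_iff_dvd_diff eq)
  have "int a ^ 2 - 1 \<noteq> 0" using dvd(1) by auto
  moreover have "int a ^ 2 + 1 \<noteq> 0" by (smt (verit) zero_le_power2)
  ultimately show "multiplicity 5 (int a ^ 4 - 1) = multiplicity 5 ((int a)^2 + 1)"
    using dvd by (simp add: eq prime_elem_multiplicity_mult_distrib not_dvd_imp_multiplicity_0)
qed

theorem corollary2p2:
  fixes a :: nat
  assumes "a > 0" and "a \<noteq> 1" and "\<not> [a = 0] (mod 10)"
  shows
    "([a = 1] (mod 20) \<longrightarrow> congruence_speed a =
        int (min (multiplicity 2 (int a - 1)) (multiplicity 5 (int a - 1)))) \<and>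
     ([a = 11] (mod 20) \<longrightarrow> congruence_speed a =
        int (min (multiplicity 2 (int a + 1)) (multiplicity 5 (int a - 1)))) \<and>
     ([a = 2] (mod 10) \<or> [a = 8] (mod 10) \<longrightarrow> congruence_speed a =
        int (multiplicity 5 ((int a)^2 + 1))) \<and>
     ([a = 3] (mod 20) \<or> [a = 7] (mod 20) \<longrightarrow> congruence_speed a =
        int (min (multiplicity 2 (int a + 1)) (multiplicity 5 ((int a)^2 + 1)))) \<and>
     ([a = 13] (mod 20) \<or> [a = 17] (mod 20) \<longrightarrow> congruence_speed a =
        int (min (multiplicity 2 (int a - 1)) (multiplicity 5 ((int a)^2 + 1)))) \<and>
     ([a = 4] (mod 10) \<longrightarrow> congruence_speed a = int (multiplicity 5 (int a + 1))) \<and>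
     ([a = 5] (mod 20) \<longrightarrow> congruence_speed a = int (multiplicity 2 (int a - 1))) \<and>
     ([a = 15] (mod 20) \<longrightarrow> congruence_speed a = int (multiplicity 2 (int a + 1))) \<and>
     ([a = 6] (mod 10) \<longrightarrow> congruence_speed a = int (multiplicity 5 (int a - 1))) \<and>
     ([a = 9] (mod 20) \<longrightarrow> congruence_speed a =
        int (min (multiplicity 2 (int a - 1)) (multiplicity 5 (int a + 1)))) \<and>
     ([a = 19] (mod 20) \<longrightarrow> congruence_speed a =
        int (min (multiplicity 2 (int a + 1)) (multiplicity 5 (int a + 1))))"
proof -
  have a: "a \<ge> 2" using assms by simp
  have mod5_1: "[int a ^ 1 = 1] (mod 5)" if "a mod 5 = 1"
    using that zmod_int[of a 5] by (simp add: cong_def)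
  have v2: "a mod 4 = 1 \<Longrightarrow> multiplicity 2 (int a ^ 2 - 1) - 1 = multiplicity 2 (int a - 1)"
    "a mod 4 = 3 \<Longrightarrow> multiplicity 2 (int a ^ 2 - 1) - 1 = multiplicity 2 (int a + 1)"
    using multiplicity_2_square_minus_1[OF a] by (simp_all add: cong_def)
  have v5: "a mod 5 = 4 \<Longrightarrow> [int a ^ 2 = 1] (mod 5)"
    "a mod 5 = 4 \<Longrightarrow> multiplicity 5 (int a ^ 2 - 1) = multiplicity 5 (int a + 1)"
    "a mod 5 = 2 \<or> a mod 5 = 3 \<Longrightarrow> [int a ^ 4 = 1] (mod 5)"
    "a mod 5 = 2 \<or> a mod 5 = 3 \<Longrightarrow>
      multiplicity 5 (int a ^ 4 - 1) = multiplicity 5 ((int a)^2 + 1)"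
    using multiplicity_5_square_minus_1[OF a] multiplicity_5_power4_minus_1[OF a]
    by (simp_all add: cong_def)
  \<comment> \<open>The exponent \<open>m\<close> is the order of \<open>a\<close> modulo 5: 1 for
    the residue 1, 2 for the residue 4, and 4 for the residues 2 and 3.\<close>
  have odd1: "congruence_speed a =
      int (min (multiplicity 2 (int a ^ 2 - 1) - 1) (multiplicity 5 (int a - 1)))"
    if "odd a" "a mod 5 = 1"
    using congruence_speed_coprime[OF a, of 1] mod5_1 that by simp
  have odd2: "congruence_speed a =
      int (min (multiplicity 2 (int a ^ 2 - 1) - 1) (multiplicity 5 (int a + 1)))"
    if "odd a" "a mod 5 = 4"
    using congruence_speed_coprime[OF a, of 2] v5 that by simp
  have odd4: "congruence_speed a =
      int (min (multiplicity 2 (int a ^ 2 - 1) - 1) (multiplicity 5 ((int a)^2 + 1)))"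
    if "odd a" "a mod 5 = 2 \<or> a mod 5 = 3"
    using congruence_speed_coprime[OF a, of 4] v5 that by simp
  have even1: "congruence_speed a = int (multiplicity 5 (int a - 1))" if "even a" "a mod 5 = 1"
    using congruence_speed_even[OF a, of 1] mod5_1 that by simp
  have even2: "congruence_speed a = int (multiplicity 5 (int a + 1))" if "even a" "a mod 5 = 4"
    using congruence_speed_even[OF a, of 2] v5 that by simp
  have even4: "congruence_speed a = int (multiplicity 5 ((int a)^2 + 1))"
    if "even a" "a mod 5 = 2 \<or> a mod 5 = 3"
    using congruence_speed_even[OF a, of 4] v5 that by simp
  have five: "congruence_speed a = int (multiplicity 2 (int a ^ 2 - 1) - 1)"
    if "odd a" "a mod 5 = 0"
    using congruence_speed_dvd_5[OF a] that by (simp add: mod_eq_0_iff_dvd)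
  have mod20: "odd a \<and> a mod 4 = r mod 4 \<and> a mod 5 = r mod 5"
    if "[a = r] (mod 20)" "odd r" for r
  proof -
    have "[a = r] (mod 2)" "[a = r] (mod 4)" "[a = r] (mod 5)"
      by (rule cong_dvd_modulus_nat[OF that(1)]; simp)+
    then show ?thesis using that(2) by (auto simp: cong_def odd_iff_mod_2_eq_one)
  qed
  have mod10: "even a \<and> a mod 5 = r mod 5" if "[a = r] (mod 10)" "even r" for r
  proof -
    have "[a = r] (mod 2)" "[a = r] (mod 5)"
      by (rule cong_dvd_modulus_nat[OF that(1)]; simp)+
    then show ?thesis using that(2) by (auto simp: cong_def even_iff_mod_2_eq_zero)
  qed
  show ?thesis
    \<comment> \<open>The modulus of each case hypothesis selects \<open>mod20\<close> or
      \<open>mod10\<close>, whose residues decide which formula applies. Unfolding \<open>1\<close>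
      in \<open>v2\<close> matches the form \<open>Suc 0\<close> to which the simplifier brings the
      subtracted 1.\<close>
    by (intro conjI impI; (elim disjE)?; drule mod20 mod10)
      (simp_all add: v2[unfolded One_nat_def] odd1 odd2 odd4 even1 even2 even4 five)
qed

end
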